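(* Let $m=1$. Then the in-degree distribution of the II-PA model and the degree distribution of the Barabási–Albert model at time $t$, $t\ge 2$, are the same, i.e., if at time $t$ there are $n$ vertices in the processes, then for any $k\in\mathbb{Z}^+$, $$\frac{\vec N_{k,t}^{\mathrm{II\text{-}PA}}}{n}=\frac{N_{k,t}^{\mathrm{BA}}}{n},$$ where $\vec N_{k,t}^{\mathrm{II\text{-}PA}}$ and $N_{k,t}^{\mathrm{BA}}$ denote the number of vertices with in-degree equal to $k$ in $(\tilde G_1^t)$ and with degree equal to $k$ in $(G_1^t)$ at time $t$, i.e., in the II-PA and Barabási–Albert models, respectively.
   Context: Both processes are random directed (multi)graph processes in discrete time $t=1,2,\dots$, starting from the empty graph at time $0$. The degree $d(v,t)$ of a vertex $v$ at time $t$ is the total number of incoming and outgoing edges at time $t$, a loop being counted twice. The in-degree $\vec d(v,t)$ is the number of incoming edges at time $t$; a directed loop contributes one to the in-degree. II-PA model with $m=1$, $(\tilde G_1^t)_{t\ge1}$: for every integer $n\ge0$, (a) at time $t=2n+1$ a new vertex $v_{n+1}$ is added together with one directed loop; (b) at time $t=2n+2$ a directed edge is added from $v_{n+1}$ to a vertex $v_j$, $1\le j\le n+1$, chosen with probability $\vec d(v_j,t-1)/(t-1)$. Barabási–Albert model with $m=1$, $(G_1^t)_{t\ge1}$, in the same time scale: for every integer $n\ge0$, (a) at time $t=2n+1$ a new vertex $v_{n+1}$ is added, with no edges; (b) at time $t=2n+2$ an edge is added from $v_{n+1}$ to a vertex $v\in\{v_1,\dots,v_{n+1}\}$ chosen with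 probability $\frac{d(v,t-1)}{2n+1}$ if $v\ne v_{n+1}$ and $\frac{d(v,t-1)+1}{2n+1}$ if $v=v_{n+1}$.
   Formalization: Equality is in law, jointly in k. For odd t only k ≥ 2 is claimed: for odd t and k = 1 the claim fails, since the newest vertex has in-degree 1 in II-PA but degree 0 in Barabási–Albert (at t = 3 the counts for k = 1 are 1 and 0). *)

theory Defs
  imports "HOL-Probability.Probability" "Graph_Theory.Digraph"
begin

text \<open>
  Vertex \<open>v\<^sub>j\<close> is the number \<open>j\<close> (\<open>j \<ge> 1\<close>). An arc is a triple
  \<open>(t, u, v)\<close>: the arc from \<open>u\<close> to \<open>v\<close> added at time \<open>t\<close>. As at most one arc is added at
  each time, the time stamp keeps parallel arcs distinct.
\<close>

type_synonym arc_t = "nat \<times> nat \<times> nat"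
type_synonym mgraph = "(nat, arc_t) pre_digraph"

definition empty_mgraph :: mgraph where
  "empty_mgraph = \<lparr>verts = {}, arcs = {}, tail = (\<lambda>(t, u, v). u), head = (\<lambda>(t, u, v). v)\<rparr>"

text \<open>A loop lies in both \<open>in_arcs\<close> and \<open>out_arcs\<close>, so it contributes two here.\<close>

definition total_degree :: "('a, 'b) pre_digraph \<Rightarrow> 'a \<Rightarrow> nat" where
  "total_degree G v = in_degree G v + out_degree G v"

definition num_in_degree :: "nat \<Rightarrow> ('a, 'b) pre_digraph \<Rightarrow> nat" where
  "num_in_degree k G = card {v \<in> verts G. in_degree G v = k}"

definition num_degree :: "nat \<Rightarrow> ('a, 'b) pre_digraph \<Rightarrow> nat" where
  "num_degree k G = card {v \<in> verts G. total_degree G v = k}"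

text \<open>
  \<open>embed_pmf\<close> yields the distribution with the given weights only if these sum to one; for
  the graphs that occur in the processes this is shown below.
\<close>

definition iipa_target :: "nat \<Rightarrow> mgraph \<Rightarrow> nat pmf" where
  "iipa_target n G =
     embed_pmf (\<lambda>v. if v \<in> {1..n + 1} then real (in_degree G v) / real (2 * n + 1) else 0)"

definition ba_target :: "nat \<Rightarrow> mgraph \<Rightarrow> nat pmf" where
  "ba_target n G =
     embed_pmf (\<lambda>v. if v \<in> {1..n} then real (total_degree G v) / real (2 * n + 1)
                    else if v = n + 1 then (real (total_degree G v) + 1) / real (2 * n + 1)
                    else 0)"

text \<open>
  \<open>iipa t\<close> and \<open>ba t\<close> are the laws of the random graphs at time \<open>t\<close>. The step to time
  \<open>Suc s\<close> is of type (a) with \<open>s = 2 * n\<close> if \<open>s\<close> is even, and of type (b) with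
  \<open>s = 2 * n + 1\<close> if \<open>s\<close> is odd.
\<close>

primrec iipa :: "nat \<Rightarrow> mgraph pmf" where
  "iipa 0 = return_pmf empty_mgraph"
| "iipa (Suc s) = bind_pmf (iipa s) (\<lambda>G. let n = s div 2 in
     if even s
     then return_pmf (pre_digraph.add_arc (pre_digraph.add_vert G (n + 1)) (Suc s, n + 1, n + 1))
     else map_pmf (\<lambda>v. pre_digraph.add_arc G (Suc s, n + 1, v)) (iipa_target n G))"

primrec ba :: "nat \<Rightarrow> mgraph pmf" where
  "ba 0 = return_pmf empty_mgraph"
| "ba (Suc s) = bind_pmf (ba s) (\<lambda>G. let n = s div 2 in
     if even s
     then return_pmf (pre_digraph.add_vert G (n + 1))
     else map_pmf (\<lambda>v. pre_digraph.add_arc G (Suc s, n + 1, v)) (ba_target n G))"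

subsection \<open>The transition probabilities sum to one\<close>

definition wf_state :: "nat \<Rightarrow> nat \<Rightarrow> mgraph \<Rightarrow> bool" where
  "wf_state s m G \<longleftrightarrow> verts G = {1..(s + 1) div 2} \<and> finite (arcs G) \<and> card (arcs G) = m
     \<and> tail G = (\<lambda>(t, u, v). u) \<and> head G = (\<lambda>(t, u, v). v)
     \<and> arcs G \<subseteq> {1..s} \<times> verts G \<times> verts G"

lemma wf_state_sums:
  assumes "wf_state s m G"
  shows "(\<Sum>v\<in>verts G. in_degree G v) = m" and "(\<Sum>v\<in>verts G. out_degree G v) = m"
proof -
  have f: "finite (arcs G)" "finite (verts G)" "card (arcs G) = m"
    using assms by (auto simp: wf_state_def)
  have "card (arcs G) = (\<Sum>v\<in>verts G. card {e \<in> arcs G. head G e = v})"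
    using assms f by (subst card_UN_disjoint[symmetric]) (auto simp: wf_state_def intro!: arg_cong[where f = card])
  then show "(\<Sum>v\<in>verts G. in_degree G v) = m"
    using f by (simp add: in_degree_def in_arcs_def)
  have "card (arcs G) = (\<Sum>v\<in>verts G. card {e \<in> arcs G. tail G e = v})"
    using assms f by (subst card_UN_disjoint[symmetric]) (auto simp: wf_state_def intro!: arg_cong[where f = card])
  then show "(\<Sum>v\<in>verts G. out_degree G v) = m"
    using f by (simp add: out_degree_def out_arcs_def)
qed

lemma pmf_embed_finite:
  fixes f :: "'a \<Rightarrow> real"
  assumes "finite A" "\<And>x. f x \<ge> 0" "\<And>x. x \<notin> A \<Longrightarrow> f x = 0" "sum f A = 1"
  shows "pmf (embed_pmf f) x = f x"
proof (rule pmf_embed_pmf)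
  have "(\<integral>\<^sup>+x. ennreal (f x) \<partial>count_space UNIV) = (\<Sum>x\<in>A. ennreal (f x))"
    using assms by (subst nn_integral_count_space'[of A]) auto
  then show "(\<integral>\<^sup>+x. ennreal (f x) \<partial>count_space UNIV) = 1"
    using assms by (simp add: sum_ennreal)
qed (use assms in auto)

lemma pmf_iipa_target:
  assumes "wf_state (2 * n + 1) (2 * n + 1) G"
  shows "pmf (iipa_target n G) v =
    (if v \<in> {1..n + 1} then real (in_degree G v) / real (2 * n + 1) else 0)"
  unfolding iipa_target_def
proof (rule pmf_embed_finite[where A = "{1..n + 1}"])
  have "verts G = {1..n + 1}" using assms by (simp add: wf_state_def)
  then have "(\<Sum>v\<in>{1..n + 1}. real (in_degree G v)) = real (2 * n + 1)"
    using wf_state_sums(1)[OF assms] by (metis of_nat_sum)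
  then show "(\<Sum>v\<in>{1..n + 1}. if v \<in> {1..n + 1} then real (in_degree G v) / real (2 * n + 1) else 0) = 1"
    by (simp add: sum_divide_distrib[symmetric] del: sum.cl_ivl_Suc)
qed auto

lemma pmf_ba_target:
  assumes "wf_state (2 * n + 1) n G"
  shows "pmf (ba_target n G) v =
    (if v \<in> {1..n} then real (total_degree G v) / real (2 * n + 1)
     else if v = n + 1 then (real (total_degree G v) + 1) / real (2 * n + 1) else 0)"
  unfolding ba_target_def
proof (rule pmf_embed_finite[where A = "{1..n + 1}"])
  have V: "verts G = {1..n + 1}" using assms by (simp add: wf_state_def)
  have "(\<Sum>v\<in>{1..n + 1}. total_degree G v) = 2 * n"
    using wf_state_sums[OF assms] unfolding V total_degree_def sum.distrib by simp
  then have "(\<Sum>v\<in>{1..n + 1}. real (total_degree G v)) = 2 * real n"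
    by (metis of_nat_sum of_nat_mult of_nat_numeral)
  then have "(\<Sum>v\<in>{1..n}. real (total_degree G v)) + real (total_degree G (n + 1)) = 2 * real n"
    by simp
  then show "(\<Sum>v\<in>{1..n + 1}. if v \<in> {1..n} then real (total_degree G v) / real (2 * n + 1)
     else if v = n + 1 then (real (total_degree G v) + 1) / real (2 * n + 1) else 0) = 1"
    by (simp add: sum_divide_distrib[symmetric] add_divide_distrib[symmetric] field_simps)
qed auto

lemma wf_state_add_vert:
  assumes "wf_state (2 * n) m G"
  shows "wf_state (2 * n + 1) m (pre_digraph.add_vert G (n + 1))"
  using assms by (auto simp: wf_state_def pre_digraph.add_vert_simps)

lemma wf_state_add_arc:
  assumes "wf_state s m G" "(s' + 1) div 2 = (s + 1) div 2" "s \<le> s'" "1 \<le> t" "t \<le> s'"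
    "u \<in> verts G" "v \<in> verts G" "\<And>a b. (t, a, b) \<notin> arcs G"
  shows "wf_state s' (Suc m) (pre_digraph.add_arc G (t, u, v))"
proof -
  let ?K = "pre_digraph.add_arc G (t, u, v)"
  have G: "verts G = {1..(s + 1) div 2}" "finite (arcs G)" "card (arcs G) = m"
    "tail G = (\<lambda>(t, u, v). u)" "head G = (\<lambda>(t, u, v). v)"
    "arcs G \<subseteq> {1..s} \<times> verts G \<times> verts G"
    using assms(1) by (auto simp: wf_state_def)
  have K: "verts ?K = verts G" "arcs ?K = insert (t, u, v) (arcs G)" "tail ?K = tail G" "head ?K = head G"
    using assms(6,7) G(4,5) by (auto simp: pre_digraph.add_arc_def)
  have "arcs G \<subseteq> {1..s'} \<times> verts G \<times> verts G"
    using G(6) assms(3) by fastforce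
  then have "arcs ?K \<subseteq> {1..s'} \<times> verts G \<times> verts G"
    using assms(4-7) K by simp
  then show ?thesis
    unfolding wf_state_def K assms(2) using G assms(8) by (simp add: K)
qed

lemma wf_state_iipa: "G \<in> set_pmf (iipa s) \<Longrightarrow> wf_state s s G"
proof (induction s arbitrary: G)
  case 0
  then show ?case by (simp add: wf_state_def empty_mgraph_def)
next
  case (Suc s)
  from Suc.prems obtain H where H: "H \<in> set_pmf (iipa s)"
    and G: "G \<in> set_pmf (let n = s div 2 in
     if even s
     then return_pmf (pre_digraph.add_arc (pre_digraph.add_vert H (n + 1)) (Suc s, n + 1, n + 1))
     else map_pmf (\<lambda>v. pre_digraph.add_arc H (Suc s, n + 1, v)) (iipa_target n H))"
    by auto
  have wf: "wf_state s s H" using Suc.IH[OF H] .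
  then have fresh: "(Suc s, a, b) \<notin> arcs H" for a b by (auto simp: wf_state_def)
  define n where "n = s div 2"
  show ?case
  proof (cases "even s")
    case True
    then have s: "s = 2 * n" by (simp add: n_def)
    have "G = pre_digraph.add_arc (pre_digraph.add_vert H (n + 1)) (Suc s, n + 1, n + 1)"
      using G True by (simp add: n_def Let_def)
    moreover have "wf_state (2 * n + 1) s (pre_digraph.add_vert H (n + 1))"
      using wf wf_state_add_vert s by simp
    ultimately show ?thesis
      using wf_state_add_arc[of "2 * n + 1" s "pre_digraph.add_vert H (n + 1)" "Suc s" "Suc s" "n + 1" "n + 1"] s fresh
      by (simp add: pre_digraph.add_vert_simps)
  next
    case False
    then have s: "s = 2 * n + 1" by (simp add: n_def)
    obtain v where v: "v \<in> set_pmf (iipa_target n H)" "G = pre_digraph.add_arc H (Suc s, n + 1, v)"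
      using G False by (auto simp: n_def Let_def)
    have "v \<in> {1..n + 1}"
      using v(1) pmf_iipa_target[of n H v] wf s by (auto simp: set_pmf_iff split: if_splits)
    moreover have "verts H = {1..n + 1}" using wf s by (simp add: wf_state_def)
    ultimately show ?thesis
      using wf_state_add_arc[OF wf, of "Suc s" "Suc s" "n + 1" v] s fresh v by simp
  qed
qed

lemma wf_state_ba: "G \<in> set_pmf (ba s) \<Longrightarrow> wf_state s (s div 2) G"
proof (induction s arbitrary: G)
  case 0
  then show ?case by (simp add: wf_state_def empty_mgraph_def)
next
  case (Suc s)
  from Suc.prems obtain H where H: "H \<in> set_pmf (ba s)"
    and G: "G \<in> set_pmf (let n = s div 2 in
     if even s
     then return_pmf (pre_digraph.add_vert H (n + 1))
     else map_pmf (\<lambda>v. pre_digraph.add_arc H (Suc s, n + 1, v)) (ba_target n H))"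
    by auto
  have wf: "wf_state s (s div 2) H" using Suc.IH[OF H] .
  then have fresh: "(Suc s, a, b) \<notin> arcs H" for a b by (auto simp: wf_state_def)
  define n where "n = s div 2"
  show ?case
  proof (cases "even s")
    case True
    then have s: "s = 2 * n" by (simp add: n_def)
    have "G = pre_digraph.add_vert H (n + 1)"
      using G True by (simp add: n_def Let_def)
    then show ?thesis
      using wf wf_state_add_vert[of n n H] s by simp
  next
    case False
    then have s: "s = 2 * n + 1" by (simp add: n_def)
    obtain v where v: "v \<in> set_pmf (ba_target n H)" "G = pre_digraph.add_arc H (Suc s, n + 1, v)"
      using G False by (auto simp: n_def Let_def)
    have "v \<in> {1..n + 1}"
      using v(1) pmf_ba_target[of n H v] wf s by (auto simp: set_pmf_iff split: if_splits)
    moreover have "verts H = {1..n + 1}" using wf s by (simp add: wf_state_def)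
    ultimately show ?thesis
      using wf_state_add_arc[OF wf, of "Suc s" "Suc s" "n + 1" v] s fresh v by simp
  qed
qed

lemma card_verts_iipa: "G \<in> set_pmf (iipa t) \<Longrightarrow> card (verts G) = (t + 1) div 2"
  using wf_state_iipa[of G t] by (simp add: wf_state_def)

lemma card_verts_ba: "G \<in> set_pmf (ba t) \<Longrightarrow> card (verts G) = (t + 1) div 2"
  using wf_state_ba[of G t] by (simp add: wf_state_def)

end

theory Submission
  imports Defs
begin

text \<open>
  The degree sequences are Markov chains of their own. Counting the half-edge that the newest
  Barabasi--Albert vertex is about to emit as already present, both chains give a new vertex
  degree 1 and then increase the degree of a vertex chosen with probability proportional to its
  degree. Hence the degree sequences, and not only the degree counts, have the same law at even
  times, and at odd times they differ only at the newest vertex, which has in-degree 1 in II-PA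
  and degree 0 in Barabasi--Albert.
\<close>

definition bump :: "('a \<Rightarrow> nat) \<Rightarrow> 'a \<Rightarrow> 'a \<Rightarrow> nat" where
  "bump d v = d(v := Suc (d v))"

text \<open>The weights see only a degree sequence, not a graph. Both target laws are identified
  with this one by comparing the arguments of \<open>embed_pmf\<close>, without evaluating any
  probability.\<close>

definition pa_target :: "nat \<Rightarrow> (nat \<Rightarrow> nat) \<Rightarrow> nat pmf" where
  "pa_target n d = embed_pmf (\<lambda>v. if v \<in> {1..n + 1} then real (d v) / real (2 * n + 1) else 0)"

definition pa_step :: "nat \<Rightarrow> (nat \<Rightarrow> nat) \<Rightarrow> (nat \<Rightarrow> nat) pmf" where
  "pa_step n d = map_pmf (bump d) (pa_target n d)"

text \<open>\<open>arcs\<close> is a set, so an arc raises a degree only if it is new; finiteness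
  lets \<open>card\<close> count the insertion.\<close>

lemma in_degree_add_arc:
  assumes "finite (arcs G)" "a \<notin> arcs G"
  shows "in_degree (pre_digraph.add_arc G a) = bump (in_degree G) (head G a)"
proof
  fix v
  have "in_arcs (pre_digraph.add_arc G a) v =
      (if v = head G a then insert a (in_arcs G v) else in_arcs G v)"
    by (auto simp: in_arcs_def pre_digraph.add_arc_def)
  moreover have "finite (in_arcs G v)"
    using assms by (auto simp: in_arcs_def)
  ultimately show "in_degree (pre_digraph.add_arc G a) v = bump (in_degree G) (head G a) v"
    using assms(2) by (auto simp: in_degree_def bump_def)
qed

lemma out_degree_add_arc:
  assumes "finite (arcs G)" "a \<notin> arcs G"
  shows "out_degree (pre_digraph.add_arc G a) = bump (out_degree G) (tail G a)"
proof
  fix v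
  have "out_arcs (pre_digraph.add_arc G a) v =
      (if v = tail G a then insert a (out_arcs G v) else out_arcs G v)"
    by (auto simp: out_arcs_def pre_digraph.add_arc_def)
  moreover have "finite (out_arcs G v)"
    using assms by (auto simp: out_arcs_def)
  ultimately show "out_degree (pre_digraph.add_arc G a) v = bump (out_degree G) (tail G a) v"
    using assms(2) by (auto simp: out_degree_def bump_def)
qed

lemma total_degree_add_arc:
  assumes "finite (arcs G)" "a \<notin> arcs G"
  shows "total_degree (pre_digraph.add_arc G a) = bump (bump (total_degree G) (tail G a)) (head G a)"
  using in_degree_add_arc[OF assms] out_degree_add_arc[OF assms]
  by (auto simp: total_degree_def bump_def fun_eq_iff)

lemma in_degree_add_vert [simp]: "in_degree (pre_digraph.add_vert G u) = in_degree G"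
  by (simp add: fun_eq_iff in_degree_def in_arcs_def pre_digraph.add_vert_def)

lemma total_degree_add_vert [simp]: "total_degree (pre_digraph.add_vert G u) = total_degree G"
  by (simp add: fun_eq_iff total_degree_def in_degree_def in_arcs_def out_degree_def out_arcs_def
      pre_digraph.add_vert_def)

text \<open>Degrees are functions on all naturals, and well-formed states have no arcs outside
  \<open>verts\<close>. This gives a vertex degree 0 before its first arc.\<close>

lemma degree_notin_verts:
  assumes "wf_state s m G" "v \<notin> verts G"
  shows "in_degree G v = 0" "total_degree G v = 0"
proof -
  have "in_arcs G v = {}" "out_arcs G v = {}"
    using assms by (auto simp: wf_state_def in_arcs_def out_arcs_def)
  then show "in_degree G v = 0" "total_degree G v = 0"
    by (simp_all add: total_degree_def in_degree_def out_degree_def)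
qed

lemma wf_state_fresh: "wf_state s m G \<Longrightarrow> (Suc s, u, v) \<notin> arcs G"
  by (auto simp: wf_state_def)

text \<open>The loop raises the in-degree of the new vertex from 0 to 1. Writing this as an
  overwrite rather than a \<open>bump\<close> matches the form of the Barabasi-Albert side.\<close>

lemma in_degree_iipa_odd:
  "map_pmf in_degree (iipa (Suc (2 * n))) =
    map_pmf (\<lambda>d. d(Suc n := 1)) (map_pmf in_degree (iipa (2 * n)))"
proof -
  have "in_degree (pre_digraph.add_arc (pre_digraph.add_vert G (n + 1)) (Suc (2 * n), n + 1, n + 1)) =
      (in_degree G)(Suc n := 1)" if "G \<in> set_pmf (iipa (2 * n))" for G
  proof -
    have wf: "wf_state (2 * n) (2 * n) G"
      by (rule wf_state_iipa[OF that])
    then have "in_degree G (Suc n) = 0"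
      by (intro degree_notin_verts[OF wf]) (simp add: wf_state_def)
    with wf wf_state_fresh[OF wf] show ?thesis
      by (subst in_degree_add_arc) (auto simp: wf_state_def pre_digraph.add_vert_simps bump_def)
  qed
  then show ?thesis
    by (simp add: map_bind_pmf map_pmf_comp map_pmf_def[of _ "iipa (2 * n)"] cong: bind_pmf_cong_simp)
qed

lemma in_degree_iipa_even:
  "map_pmf in_degree (iipa (Suc (Suc (2 * n)))) =
    bind_pmf (map_pmf in_degree (iipa (Suc (2 * n)))) (pa_step n)"
proof -
  have "map_pmf in_degree (iipa (Suc (Suc (2 * n)))) = bind_pmf (iipa (Suc (2 * n)))
      (\<lambda>G. map_pmf in_degree (map_pmf (\<lambda>v. pre_digraph.add_arc G (Suc (Suc (2 * n)), n + 1, v))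
        (iipa_target n G)))"
    by (subst iipa.simps(2)) (simp add: map_bind_pmf Let_def del: iipa.simps(2))
  also have "\<dots> = bind_pmf (iipa (Suc (2 * n))) (\<lambda>G. pa_step n (in_degree G))"
  proof (rule bind_pmf_cong[OF refl])
    fix G assume "G \<in> set_pmf (iipa (Suc (2 * n)))"
    then have wf: "wf_state (Suc (2 * n)) (Suc (2 * n)) G"
      by (rule wf_state_iipa)
    have "in_degree (pre_digraph.add_arc G (Suc (Suc (2 * n)), n + 1, v)) = bump (in_degree G) v" for v
      using wf wf_state_fresh[OF wf] by (subst in_degree_add_arc) (auto simp: wf_state_def)
    then show "map_pmf in_degree (map_pmf (\<lambda>v. pre_digraph.add_arc G (Suc (Suc (2 * n)), n + 1, v))
        (iipa_target n G)) = pa_step n (in_degree G)"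
      by (simp add: map_pmf_comp pa_step_def pa_target_def iipa_target_def)
  qed
  finally show ?thesis
    by (simp add: bind_map_pmf del: iipa.simps(2))
qed

lemma total_degree_ba_odd:
  "map_pmf total_degree (ba (Suc (2 * n))) = map_pmf total_degree (ba (2 * n))"
  by (simp add: map_bind_pmf map_pmf_def[of _ "ba (2 * n)"])

lemma total_degree_ba_newest:
  assumes "G \<in> set_pmf (ba (Suc (2 * n)))"
  shows "total_degree G (Suc n) = 0"
proof -
  from assms obtain H where H: "H \<in> set_pmf (ba (2 * n))" "G = pre_digraph.add_vert H (Suc n)"
    by auto
  note wf = wf_state_ba[OF H(1)]
  have "total_degree H (Suc n) = 0"
    using wf by (intro degree_notin_verts[OF wf]) (simp add: wf_state_def)
  then show ?thesis
    using H(2) by simp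
qed

lemma total_degree_ba_even:
  "map_pmf total_degree (ba (Suc (Suc (2 * n)))) =
    bind_pmf (map_pmf (\<lambda>d. d(Suc n := 1)) (map_pmf total_degree (ba (Suc (2 * n))))) (pa_step n)"
proof -
  have "map_pmf total_degree (ba (Suc (Suc (2 * n)))) = bind_pmf (ba (Suc (2 * n)))
      (\<lambda>G. map_pmf total_degree (map_pmf (\<lambda>v. pre_digraph.add_arc G (Suc (Suc (2 * n)), n + 1, v))
        (ba_target n G)))"
    by (subst ba.simps(2)) (simp add: map_bind_pmf Let_def del: ba.simps(2))
  also have "\<dots> = bind_pmf (ba (Suc (2 * n))) (\<lambda>G. pa_step n ((total_degree G)(Suc n := 1)))"
  proof (rule bind_pmf_cong[OF refl])
    fix G assume G: "G \<in> set_pmf (ba (Suc (2 * n)))"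
    note wf = wf_state_ba[OF G] and new = total_degree_ba_newest[OF G]
    \<comment> \<open>The bump at the tail \<open>n + 1\<close> turns its degree 0 into 1, which is
      the overwrite; the bump at the head \<open>v\<close> remains. A loop,
      \<open>v = n + 1\<close>, ends with degree 2.\<close>
    have "total_degree (pre_digraph.add_arc G (Suc (Suc (2 * n)), n + 1, v)) =
        bump ((total_degree G)(Suc n := 1)) v" for v
      using wf wf_state_fresh[OF wf] new
      by (subst total_degree_add_arc) (auto simp: wf_state_def bump_def)
    \<comment> \<open>The newest vertex has degree 0, so its special weight numerator 0 + 1 is just
      its overwritten degree.\<close>
    moreover have "ba_target n G = pa_target n ((total_degree G)(Suc n := 1))"
      unfolding ba_target_def pa_target_def using new
      by (intro arg_cong[where f = embed_pmf] ext) auto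
    ultimately show "map_pmf total_degree (map_pmf (\<lambda>v. pre_digraph.add_arc G
        (Suc (Suc (2 * n)), n + 1, v)) (ba_target n G)) = pa_step n ((total_degree G)(Suc n := 1))"
      by (simp add: map_pmf_comp pa_step_def)
  qed
  finally show ?thesis
    by (simp add: bind_map_pmf del: ba.simps(2))
qed

text \<open>Conditional so that it can serve inside the induction, where the law at time
  \<open>2 * n\<close> is only the induction hypothesis.\<close>

lemma degree_law_odd_if_even:
  assumes "map_pmf in_degree (iipa (2 * n)) = map_pmf total_degree (ba (2 * n))"
  shows "map_pmf in_degree (iipa (Suc (2 * n))) =
    map_pmf (\<lambda>d. d(Suc n := 1)) (map_pmf total_degree (ba (Suc (2 * n))))"
  unfolding in_degree_iipa_odd total_degree_ba_odd assms ..

lemma degree_law_even: "map_pmf in_degree (iipa (2 * n)) = map_pmf total_degree (ba (2 * n))"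
proof (induction n)
  case 0
  have "in_degree empty_mgraph = total_degree empty_mgraph"
    by (simp add: fun_eq_iff total_degree_def in_degree_def out_degree_def in_arcs_def out_arcs_def
        empty_mgraph_def)
  then show ?case
    by simp
next
  case (Suc n)
  have "map_pmf in_degree (iipa (Suc (Suc (2 * n)))) = map_pmf total_degree (ba (Suc (Suc (2 * n))))"
    \<comment> \<open>Both sides run \<open>pa_step n\<close> from laws at the odd time in between,
      and these coincide by the induction hypothesis.\<close>
    unfolding in_degree_iipa_even total_degree_ba_even degree_law_odd_if_even[OF Suc.IH] ..
  then show ?case
    by (simp del: iipa.simps(2) ba.simps(2))
qed

lemmas degree_law_odd = degree_law_odd_if_even[OF degree_law_even]

text \<open>Equality is in law, jointly in \<open>k\<close>. At odd times \<open>k\<close> starts at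
  2: the newest vertex has in-degree 1 in II-PA but degree 0 in Barabasi-Albert, so the laws of the
  counts at \<open>k = 1\<close> are shifted by one.\<close>

theorem theorem4p1:
  fixes t n :: nat
  assumes "t \<ge> 2"
    and "\<forall>G\<in>set_pmf (iipa t). card (verts G) = n"
    and "\<forall>G\<in>set_pmf (ba t). card (verts G) = n"
  shows "(even t \<longrightarrow>
      map_pmf (\<lambda>G. \<lambda>k\<in>{1..}. real (num_in_degree k G) / real n) (iipa t) =
      map_pmf (\<lambda>G. \<lambda>k\<in>{1..}. real (num_degree k G) / real n) (ba t)) \<and>
    (odd t \<longrightarrow>
      map_pmf (\<lambda>G. \<lambda>k\<in>{2..}. real (num_in_degree k G) / real n) (iipa t) =
      map_pmf (\<lambda>G. \<lambda>k\<in>{2..}. real (num_degree k G) / real n) (ba t))"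
proof -
  define V where "V = {1..(t + 1) div 2}"
  \<comment> \<open>The vertex set at time \<open>t\<close> is deterministic, so the normalised
    counts are a fixed function of the degree sequence.\<close>
  define F where "F A d = (\<lambda>k\<in>A. real (card {v \<in> V. d v = k}) / real n)" for A and d :: "nat \<Rightarrow> nat"
  have iipa: "map_pmf (\<lambda>G. \<lambda>k\<in>A. real (num_in_degree k G) / real n) (iipa t) =
      map_pmf (F A) (map_pmf in_degree (iipa t))" for A
    unfolding map_pmf_comp
    by (intro map_pmf_cong refl) (auto dest!: wf_state_iipa simp: wf_state_def F_def V_def num_in_degree_def)
  have ba: "map_pmf (\<lambda>G. \<lambda>k\<in>A. real (num_degree k G) / real n) (ba t) =
      map_pmf (F A) (map_pmf total_degree (ba t))" for A
    unfolding map_pmf_comp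
    by (intro map_pmf_cong refl) (auto dest!: wf_state_ba simp: wf_state_def F_def V_def num_degree_def)
  show ?thesis
    unfolding iipa ba
  proof (intro conjI impI)
    assume "even t"
    then show "map_pmf (F {1..}) (map_pmf in_degree (iipa t)) =
        map_pmf (F {1..}) (map_pmf total_degree (ba t))"
      by (metis degree_law_even evenE)
  next
    assume "odd t"
    then obtain m where t: "t = Suc (2 * m)"
      by (auto elim: oddE)
    \<comment> \<open>Overwriting moves the newest vertex from degree 0 to 1, which no count with
      \<open>k\<close> at least 2 sees.\<close>
    have "F {2..} ((total_degree G)(Suc m := 1)) = F {2..} (total_degree G)"
      if "G \<in> set_pmf (ba t)" for G
    proof -
      have "total_degree G (Suc m) = 0"
        using that total_degree_ba_newest t by blast
      then have "{v \<in> V. ((total_degree G)(Suc m := 1)) v = k} = {v \<in> V. total_degree G v = k}"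
        if "k \<ge> 2" for k
        using that by auto
      then show ?thesis
        unfolding F_def by (intro restrict_ext) auto
    qed
    then show "map_pmf (F {2..}) (map_pmf in_degree (iipa t)) =
        map_pmf (F {2..}) (map_pmf total_degree (ba t))"
      unfolding t degree_law_odd map_pmf_comp by (intro map_pmf_cong refl) auto
  qed
qed

end
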